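(* Let $C$ be a category, let $S\colon C\to\Delta(\mathsf{Set})$ be a functor to the category of simplicial sets, and let $n\in\mathbb{N}_{>0}$. Assume that $C$ contains an object $\bullet$ such that $S(\bullet)$ is the one-point simplicial set $P$ (with $P(m)=\{\emptyset\}$ for all $m\in\mathbb{N}$). Let $X$ be an object of $C$ that is replicable and pointable (with respect to $S$), and let $\alpha\in H_n^{\ell^1,S}(X)$. Then the following are equivalent: (1) The class $\alpha$ is weakly flexible with respect to $H_n^{\ell^1,S}$. (2) All finite homogeneous functorial semi-norms on $H_n^{\ell^1,S}$ are zero on $\alpha$. (3) $\|\alpha\|_1=0$.
   Context: For a simplicial set $K$, let $\mathrm{Ch}_{\mathbb{R}}(K)$ be the chain complex whose $m$-th chain module is the free $\mathbb{R}$-module with basis the set $K(m)$ of $m$-simplices, with boundary operator the alternating sum of the face maps. Equip it with the $\ell^1$-norm $|\sum_s a_s\cdot s|_1=\sum_s|a_s|$. The boundary operators are bounded; let $\mathrm{Ch}^{\ell^1}_{\mathbb{R}}(K)$ be the degreewise completion with respect to the $\ell^1$-norm (so its $m$-chains are the absolutely summable families $\sum_{s\in K(m)}a_s\cdot s$ with real coefficients), with the continuously extended boundary operators and the extended norm $|\cdot|_1$. This is functorial in $K$. Define $$H_n^{\ell^1,S}:=H_n\circ\mathrm{Ch}^{\ell^1}_{\mathbb{R}}\circ S\colon C\to\mathsf{Ab},$$ where $H_n$ is the $n$-th (algebraic) homology of the chain complex, i.e. kernel modulo image. For $\alpha\in H_n^{\ell^1,S}(X)$ set $\|\alpha\|_1=\inf\{|c|_1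 \mid c\in\mathrm{Ch}^{\ell^1}_{\mathbb{R}}(S(X))_n,\ \partial c=0,\ [c]=\alpha\}$; this is a finite homogeneous functorial semi-norm. An object $X$ of $C$ is replicable if the coproduct $\coprod_{\mathbb{N}}X$ of countably infinitely many copies of $X$ exists in $C$; it is pointable (with respect to $S$) if $\mathrm{Mor}_C(\bullet,X)$ and $\mathrm{Mor}_C(X,\bullet)$ are non-empty. For a functor $F\colon C\to\mathsf{Ab}$, an element $\alpha\in F(X)$ is weakly flexible with respect to $F$ if there exist an object $Y$ of $C$ and $\beta\in F(Y)$ such that $D(\beta,\alpha)=\{d\in\mathbb{Z}\mid\exists f\in\mathrm{Mor}_C(Y,X):\ F(f)(\beta)=d\cdot\alpha\}$ is infinite. A finite semi-norm on an Abelian group $A$ is a map $|\cdot|\colon A\to\mathbb{R}_{\ge0}$ with $|0|=0$, $|-x|=|x|$, $|x+y|\le|x|+|y|$; it is homogeneous if $|m\cdot x|=|m|\cdot|x|$ for all $m\in\mathbb{Z}\setminus\{0\}$ and all $x\in A$. A finite (homogeneous) functorial semi-norm on $F\colon C\to\mathsf{Ab}$ is a choice of a finite (homogeneous) semi-norm on $F(X)$ for every object $X$ of $C$ such that $|F(f)(\alpha)|\le|\alpha|$ for all morphisms $f\colon X\to Y$ in $C$ and all $\alpha\in F(X)$. *)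

theory Defs
  imports "HOL-Algebra.Coset" "HOL-Analysis.Infinite_Sum" "HOL-Library.FuncSet"
begin

section \<open>Categories\<close>

record ('o, 'a) category =
  Ob :: "'o set"
  Ar :: "'a set"
  Dom :: "'a \<Rightarrow> 'o"
  Cod :: "'a \<Rightarrow> 'o"
  Ident :: "'o \<Rightarrow> 'a"
  Comp :: "'a \<Rightarrow> 'a \<Rightarrow> 'a"  \<comment> \<open>\<open>Comp C g f\<close> is "g after f"\<close>

definition Mor :: "('o, 'a) category \<Rightarrow> 'o \<Rightarrow> 'o \<Rightarrow> 'a set"
  where "Mor C X Y = {f \<in> Ar C. Dom C f = X \<and> Cod C f = Y}"

locale category =
  fixes C :: "('o, 'a) category"
  assumes Dom_Ob: "f \<in> Ar C \<Longrightarrow> Dom C f \<in> Ob C"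
    and Cod_Ob: "f \<in> Ar C \<Longrightarrow> Cod C f \<in> Ob C"
    and Ident_Mor: "X \<in> Ob C \<Longrightarrow> Ident C X \<in> Mor C X X"
    and Comp_Mor: "f \<in> Mor C X Y \<Longrightarrow> g \<in> Mor C Y Z \<Longrightarrow> Comp C g f \<in> Mor C X Z"
    and Comp_Ident_right: "f \<in> Mor C X Y \<Longrightarrow> Comp C f (Ident C X) = f"
    and Comp_Ident_left: "f \<in> Mor C X Y \<Longrightarrow> Comp C (Ident C Y) f = f"
    and Comp_assoc: "f \<in> Mor C W X \<Longrightarrow> g \<in> Mor C X Y \<Longrightarrow> h \<in> Mor C Y Z \<Longrightarrow>
          Comp C h (Comp C g f) = Comp C (Comp C h g) f"

definition is_coproduct ::
  "('o, 'a) category \<Rightarrow> 'i set \<Rightarrow> ('i \<Rightarrow> 'o) \<Rightarrow> 'o \<Rightarrow> ('i \<Rightarrow> 'a) \<Rightarrow> bool"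
  where "is_coproduct C I A Y \<iota> \<longleftrightarrow>
    Y \<in> Ob C \<and> (\<forall>i\<in>I. \<iota> i \<in> Mor C (A i) Y) \<and>
    (\<forall>Z\<in>Ob C. \<forall>g. (\<forall>i\<in>I. g i \<in> Mor C (A i) Z) \<longrightarrow>
       (\<exists>!h. h \<in> Mor C Y Z \<and> (\<forall>i\<in>I. Comp C h (\<iota> i) = g i)))"

definition replicable :: "('o, 'a) category \<Rightarrow> 'o \<Rightarrow> bool"
  where "replicable C X \<longleftrightarrow> (\<exists>Y \<iota>. is_coproduct C (UNIV :: nat set) (\<lambda>_. X) Y \<iota>)"

definition pointable :: "('o, 'a) category \<Rightarrow> 'o \<Rightarrow> 'o \<Rightarrow> bool"
  where "pointable C pt X \<longleftrightarrow> Mor C pt X \<noteq> {} \<and> Mor C X pt \<noteq> {}"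


section \<open>Simplicial sets\<close>

text \<open>The morphisms from \<open>[m]\<close> to \<open>[n]\<close> of the simplex category are the monotone maps
  \<open>{0..m} \<rightarrow> {0..n}\<close>, encoded as functions on \<open>nat\<close> that are \<open>undefined\<close> outside \<open>{0..m}\<close>, so
  that equality of functions is equality of morphisms.\<close>

definition simplex_mor :: "nat \<Rightarrow> nat \<Rightarrow> (nat \<Rightarrow> nat) set"
  where "simplex_mor m n = {\<theta> \<in> {0..m} \<rightarrow>\<^sub>E {0..n}. mono_on {0..m} \<theta>}"

text \<open>\<open>act K m n \<theta> : K(n) \<rightarrow> K(m)\<close> is the value of the contravariant functor \<open>K\<close> at
  \<open>\<theta> : [m] \<rightarrow> [n]\<close>.\<close>

record 's sset =
  simplices :: "nat \<Rightarrow> 's set"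
  act :: "nat \<Rightarrow> nat \<Rightarrow> (nat \<Rightarrow> nat) \<Rightarrow> 's \<Rightarrow> 's"

locale simplicial_set =
  fixes K :: "'s sset"
  assumes act_closed: "\<theta> \<in> simplex_mor m n \<Longrightarrow> s \<in> simplices K n \<Longrightarrow> act K m n \<theta> s \<in> simplices K m"
    and act_id: "s \<in> simplices K m \<Longrightarrow> act K m m (\<lambda>i\<in>{0..m}. i) s = s"
    and act_comp: "\<eta> \<in> simplex_mor l m \<Longrightarrow> \<theta> \<in> simplex_mor m n \<Longrightarrow> s \<in> simplices K n \<Longrightarrow>
          act K l n (compose {0..l} \<theta> \<eta>) s = act K l m \<eta> (act K m n \<theta> s)"

definition simplicial_map :: "'s sset \<Rightarrow> 't sset \<Rightarrow> (nat \<Rightarrow> 's \<Rightarrow> 't) \<Rightarrow> bool"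
  where "simplicial_map K L \<phi> \<longleftrightarrow>
    (\<forall>m. \<phi> m \<in> simplices K m \<rightarrow> simplices L m) \<and>
    (\<forall>m n. \<forall>\<theta>\<in>simplex_mor m n. \<forall>s\<in>simplices K n.
       \<phi> m (act K m n \<theta> s) = act L m n \<theta> (\<phi> n s))"

definition sset_iso :: "'s sset \<Rightarrow> 't sset \<Rightarrow> bool"
  where "sset_iso K L \<longleftrightarrow>
    (\<exists>\<phi> \<psi>. simplicial_map K L \<phi> \<and> simplicial_map L K \<psi> \<and>
       (\<forall>m. \<forall>s\<in>simplices K m. \<psi> m (\<phi> m s) = s) \<and>
       (\<forall>m. \<forall>t\<in>simplices L m. \<phi> m (\<psi> m t) = t))"

definition point_sset :: "unit sset"
  where "point_sset = \<lparr>simplices = (\<lambda>_. {()}), act = (\<lambda>_ _ _ s. s)\<rparr>"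

text \<open>All simplices of all values of a functor to simplicial sets live in one type \<open>'s\<close>.\<close>

record ('o, 'a, 's) sset_functor =
  sobj :: "'o \<Rightarrow> 's sset"
  smor :: "'a \<Rightarrow> nat \<Rightarrow> 's \<Rightarrow> 's"

locale sset_functor = category C for C :: "('o, 'a) category" +
  fixes S :: "('o, 'a, 's) sset_functor"
  assumes sobj_sset: "X \<in> Ob C \<Longrightarrow> simplicial_set (sobj S X)"
    and smor_map: "f \<in> Mor C X Y \<Longrightarrow> simplicial_map (sobj S X) (sobj S Y) (smor S f)"
    and smor_id: "X \<in> Ob C \<Longrightarrow> s \<in> simplices (sobj S X) m \<Longrightarrow> smor S (Ident C X) m s = s"
    and smor_comp: "f \<in> Mor C X Y \<Longrightarrow> g \<in> Mor C Y Z \<Longrightarrow> s \<in> simplices (sobj S X) m \<Longrightarrow>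
          smor S (Comp C g f) m s = smor S g m (smor S f m s)"


section \<open>\<open>\<ell>\<^sup>1\<close>-chains and \<open>\<ell>\<^sup>1\<close>-homology\<close>

definition coface :: "nat \<Rightarrow> nat \<Rightarrow> nat \<Rightarrow> nat"
  where "coface m i = (\<lambda>j\<in>{0..m}. if j < i then j else Suc j)"

text \<open>\<open>face K m i : K(m+1) \<rightarrow> K(m)\<close> is the \<open>i\<close>-th face map, \<open>i \<le> m + 1\<close>.\<close>

definition face :: "'s sset \<Rightarrow> nat \<Rightarrow> nat \<Rightarrow> 's \<Rightarrow> 's"
  where "face K m i = act K m (Suc m) (coface m i)"

definition l1_chains :: "nat \<Rightarrow> 's sset \<Rightarrow> ('s \<Rightarrow> real) set"
  where "l1_chains m K =
    {c. (\<forall>s. s \<notin> simplices K m \<longrightarrow> c s = 0) \<and> (\<lambda>s. \<bar>c s\<bar>) summable_on simplices K m}"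

definition l1_norm :: "nat \<Rightarrow> 's sset \<Rightarrow> ('s \<Rightarrow> real) \<Rightarrow> real"
  where "l1_norm m K c = (\<Sum>\<^sub>\<infinity>s\<in>simplices K m. \<bar>c s\<bar>)"

definition l1_chain_group :: "nat \<Rightarrow> 's sset \<Rightarrow> ('s \<Rightarrow> real) monoid"
  where "l1_chain_group m K =
    \<lparr>carrier = l1_chains m K, monoid.mult = (\<lambda>c d s. c s + d s), one = (\<lambda>s. 0)\<rparr>"

text \<open>The continuous linear extension to \<open>\<ell>\<^sup>1\<close>-chains of a map \<open>\<phi>\<close> defined on simplices:
  it sends \<open>\<Sum>\<^sub>s c(s) \<cdot> s\<close> to \<open>\<Sum>\<^sub>s c(s) \<cdot> \<phi>(s)\<close>.\<close>

definition l1_push :: "'s set \<Rightarrow> ('s \<Rightarrow> 't) \<Rightarrow> ('s \<Rightarrow> real) \<Rightarrow> 't \<Rightarrow> real"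
  where "l1_push A \<phi> c t = (\<Sum>\<^sub>\<infinity>s\<in>{s \<in> A. \<phi> s = t}. c s)"

text \<open>The boundary operator from degree \<open>m\<close> to degree \<open>m - 1\<close>; it vanishes in degree \<open>0\<close>.\<close>

definition l1_boundary :: "nat \<Rightarrow> 's sset \<Rightarrow> ('s \<Rightarrow> real) \<Rightarrow> 's \<Rightarrow> real"
  where "l1_boundary m K c = (case m of 0 \<Rightarrow> (\<lambda>t. 0)
    | Suc k \<Rightarrow> (\<lambda>t. \<Sum>i\<le>Suc k. (-1) ^ i * l1_push (simplices K (Suc k)) (face K k i) c t))"

text \<open>On a simplex the boundary is the alternating sum of the faces, and the boundary operator is
  additive and bounded; by density of the finitely supported chains it is therefore the continuous
  extension of the simplicial boundary operator.\<close>

lemma l1_boundary_simplex: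
  assumes "s \<in> simplices K (Suc k)"
  shows "l1_boundary (Suc k) K (\<lambda>u. of_bool (u = s)) =
    (\<lambda>t. \<Sum>i\<le>Suc k. (-1) ^ i * of_bool (t = face K k i s))"
proof -
  have "l1_push (simplices K (Suc k)) \<phi> (\<lambda>u. of_bool (u = s)) t = of_bool (t = \<phi> s)"
    for \<phi> :: "'a \<Rightarrow> 'a" and t
  proof -
    have "l1_push (simplices K (Suc k)) \<phi> (\<lambda>u. of_bool (u = s)) t =
        (\<Sum>\<^sub>\<infinity>u\<in>(if t = \<phi> s then {s} else {}). of_bool (u = s))"
      unfolding l1_push_def by (rule infsum_cong_neutral) (use assms in auto)
    then show ?thesis by simp
  qed
  then show ?thesis
    by (simp add: l1_boundary_def)
qed

lemma l1_push_add:
  assumes "c \<in> l1_chains m K" and "d \<in> l1_chains m K"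
  shows "l1_push (simplices K m) \<phi> (\<lambda>s. c s + d s) t =
    l1_push (simplices K m) \<phi> c t + l1_push (simplices K m) \<phi> d t"
proof -
  have "e summable_on {s \<in> simplices K m. \<phi> s = t}" if "e \<in> l1_chains m K" for e
  proof -
    have "e summable_on simplices K m"
      using that by (auto simp: l1_chains_def intro: abs_summable_summable)
    then show ?thesis by (rule summable_on_subset_banach) auto
  qed
  then show ?thesis
    unfolding l1_push_def using assms by (intro infsum_add) auto
qed

lemma l1_boundary_add:
  assumes "c \<in> l1_chains m K" and "d \<in> l1_chains m K"
  shows "l1_boundary m K (\<lambda>s. c s + d s) = (\<lambda>t. l1_boundary m K c t + l1_boundary m K d t)"
proof (cases m)
  case 0
  then show ?thesis by (simp add: l1_boundary_def)
next
  case (Suc k)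
  have "l1_push (simplices K (Suc k)) \<phi> (\<lambda>s. c s + d s) t =
      l1_push (simplices K (Suc k)) \<phi> c t + l1_push (simplices K (Suc k)) \<phi> d t"
    for \<phi> :: "'a \<Rightarrow> 'a" and t
    by (rule l1_push_add[OF assms, unfolded Suc])
  then show ?thesis
    by (simp only: l1_boundary_def Suc nat.case distrib_left sum.distrib)
qed

lemma l1_push_bounded:
  assumes c: "c \<in> l1_chains m K" and \<phi>: "\<phi> \<in> simplices K m \<rightarrow> simplices L k"
  shows "l1_push (simplices K m) \<phi> c \<in> l1_chains k L"
    and "l1_norm k L (l1_push (simplices K m) \<phi> c) \<le> l1_norm m K c"
proof -
  let ?A = "simplices K m" and ?B = "simplices L k"
  let ?F = "\<lambda>t. {s \<in> ?A. \<phi> s = t}"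
  let ?\<pi> = "\<lambda>s. (\<phi> s, s)"
  have abs: "(\<lambda>s. \<bar>c s\<bar>) summable_on ?A"
    using c by (simp add: l1_chains_def)
  have bij: "bij_betw ?\<pi> ?A (Sigma ?B ?F)"
    using \<phi> by (auto simp: bij_betw_def inj_on_def image_iff)
  have S: "(\<lambda>(t, s). \<bar>c s\<bar>) summable_on Sigma ?B ?F"
    using abs summable_on_reindex_bij_betw[OF bij, of "\<lambda>(t, s). \<bar>c s\<bar>"] by simp
  have fib: "(\<lambda>s. \<bar>c s\<bar>) summable_on ?F t" for t
    by (rule summable_on_subset_banach[OF abs]) auto
  have le: "\<bar>l1_push ?A \<phi> c t\<bar> \<le> (\<Sum>\<^sub>\<infinity>s\<in>?F t. \<bar>c s\<bar>)" for t
    using norm_infsum_bound[of c "?F t"] fib by (simp add: l1_push_def)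
  have sums: "(\<lambda>t. \<Sum>\<^sub>\<infinity>s\<in>?F t. \<bar>c s\<bar>) summable_on ?B"
    using summable_on_Sigma_banach[OF S] by simp
  have push: "(\<lambda>t. \<bar>l1_push ?A \<phi> c t\<bar>) summable_on ?B"
    by (rule summable_on_comparison_test[OF sums]) (use le in auto)
  have zero: "l1_push ?A \<phi> c t = 0" if "t \<notin> ?B" for t
  proof -
    have "?F t = {}" using that \<phi> by auto
    then show ?thesis by (simp only: l1_push_def infsum_empty)
  qed
  show "l1_push ?A \<phi> c \<in> l1_chains k L"
    using push zero by (simp add: l1_chains_def)
  have "l1_norm k L (l1_push ?A \<phi> c) \<le> (\<Sum>\<^sub>\<infinity>t\<in>?B. \<Sum>\<^sub>\<infinity>s\<in>?F t. \<bar>c s\<bar>)"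
    unfolding l1_norm_def by (rule infsum_mono[OF push sums]) (rule le)
  also have "\<dots> = (\<Sum>\<^sub>\<infinity>(t, s)\<in>Sigma ?B ?F. \<bar>c s\<bar>)"
    using infsum_Sigma'_banach[OF S] by simp
  also have "\<dots> = (\<Sum>\<^sub>\<infinity>s\<in>?A. \<bar>c s\<bar>)"
    using infsum_reindex_bij_betw[OF bij, of "\<lambda>(t, s). \<bar>c s\<bar>"] by simp
  finally show "l1_norm k L (l1_push ?A \<phi> c) \<le> l1_norm m K c"
    by (simp add: l1_norm_def)
qed

lemma coface_mor: "coface m i \<in> simplex_mor m (Suc m)"
  by (auto simp: coface_def simplex_mor_def mono_on_def)

lemma l1_boundary_bounded:
  assumes "simplicial_set K" and c: "c \<in> l1_chains (Suc k) K"
  shows "l1_boundary (Suc k) K c \<in> l1_chains k K"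
    and "l1_norm k K (l1_boundary (Suc k) K c) \<le> (real k + 2) * l1_norm (Suc k) K c"
proof -
  interpret simplicial_set K by fact
  let ?p = "\<lambda>i. l1_push (simplices K (Suc k)) (face K k i) c"
  have face: "face K k i \<in> simplices K (Suc k) \<rightarrow> simplices K k" for i
    using act_closed[OF coface_mor] by (auto simp: face_def)
  note p = l1_push_bounded[OF c face]
  have b: "l1_boundary (Suc k) K c = (\<lambda>t. \<Sum>i\<le>Suc k. (-1) ^ i * ?p i t)"
    by (simp add: l1_boundary_def)
  have le: "\<bar>l1_boundary (Suc k) K c t\<bar> \<le> (\<Sum>i\<le>Suc k. \<bar>?p i t\<bar>)" for t
    unfolding b by (rule order.trans[OF sum_abs]) (simp add: abs_mult power_abs)
  have pi: "(\<lambda>t. \<bar>?p i t\<bar>) summable_on simplices K k" for i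
    using p(1)[of i] by (simp add: l1_chains_def)
  have "((\<lambda>t. \<Sum>i\<in>I. \<bar>?p i t\<bar>) has_sum (\<Sum>i\<in>I. l1_norm k K (?p i))) (simplices K k)"
    if "finite I" for I
    using that by induction (auto simp: l1_norm_def intro!: has_sum_add has_sum_infsum pi)
  then have hs: "((\<lambda>t. \<Sum>i\<le>Suc k. \<bar>?p i t\<bar>) has_sum (\<Sum>i\<le>Suc k. l1_norm k K (?p i)))
      (simplices K k)"
    by blast
  then have ps: "(\<lambda>t. \<Sum>i\<le>Suc k. \<bar>?p i t\<bar>) summable_on simplices K k"
    by (rule has_sum_imp_summable)
  have bs: "(\<lambda>t. \<bar>l1_boundary (Suc k) K c t\<bar>) summable_on simplices K k"
    by (rule summable_on_comparison_test[OF ps]) (use le in auto)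
  have "l1_boundary (Suc k) K c t = 0" if "t \<notin> simplices K k" for t
    using p(1) that unfolding b l1_chains_def by (intro sum.neutral) auto
  with bs show "l1_boundary (Suc k) K c \<in> l1_chains k K"
    by (simp add: l1_chains_def)
  have "l1_norm k K (l1_boundary (Suc k) K c) \<le> (\<Sum>\<^sub>\<infinity>t\<in>simplices K k. \<Sum>i\<le>Suc k. \<bar>?p i t\<bar>)"
    unfolding l1_norm_def by (rule infsum_mono[OF bs ps]) (rule le)
  also have "\<dots> = (\<Sum>i\<le>Suc k. l1_norm k K (?p i))"
    using hs by (rule infsumI)
  also have "\<dots> \<le> (\<Sum>i\<le>Suc k. l1_norm (Suc k) K c)"
    by (intro sum_mono p(2))
  finally show "l1_norm k K (l1_boundary (Suc k) K c) \<le> (real k + 2) * l1_norm (Suc k) K c"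
    by (simp add: algebra_simps)
qed

definition l1_cycles :: "nat \<Rightarrow> 's sset \<Rightarrow> ('s \<Rightarrow> real) set"
  where "l1_cycles m K = {c \<in> l1_chains m K. l1_boundary m K c = (\<lambda>t. 0)}"

definition l1_boundaries :: "nat \<Rightarrow> 's sset \<Rightarrow> ('s \<Rightarrow> real) set"
  where "l1_boundaries m K = l1_boundary (Suc m) K ` l1_chains (Suc m) K"

text \<open>Homology classes are cosets of the boundaries in the group of cycles; in accordance with
  HOL-Algebra, homology groups are written multiplicatively.\<close>

definition l1_cycle_group :: "nat \<Rightarrow> 's sset \<Rightarrow> ('s \<Rightarrow> real) monoid"
  where "l1_cycle_group m K = (l1_chain_group m K)\<lparr>carrier := l1_cycles m K\<rparr>"

definition l1_homology_group :: "nat \<Rightarrow> 's sset \<Rightarrow> ('s \<Rightarrow> real) set monoid"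
  where "l1_homology_group m K = l1_cycle_group m K Mod l1_boundaries m K"

definition l1_class :: "nat \<Rightarrow> 's sset \<Rightarrow> ('s \<Rightarrow> real) \<Rightarrow> ('s \<Rightarrow> real) set"
  where "l1_class m K c = l1_boundaries m K #>\<^bsub>l1_cycle_group m K\<^esub> c"

text \<open>The map induced in homology sends the class \<open>[c]\<close> to \<open>[\<phi>\<^sub>* c]\<close>. As a class is the set of its
  representing cycles and all classes \<open>[\<phi>\<^sub>* c]\<close> with \<open>c\<close> in a given class coincide, this common
  value is their union.\<close>

definition l1_homology_map ::
  "nat \<Rightarrow> 's sset \<Rightarrow> 't sset \<Rightarrow> (nat \<Rightarrow> 's \<Rightarrow> 't) \<Rightarrow> ('s \<Rightarrow> real) set \<Rightarrow> ('t \<Rightarrow> real) set"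
  where "l1_homology_map m K L \<phi> \<alpha> =
    (\<Union>c\<in>\<alpha>. l1_class m L (l1_push (simplices K m) (\<phi> m) c))"

definition l1_seminorm :: "nat \<Rightarrow> 's sset \<Rightarrow> ('s \<Rightarrow> real) set \<Rightarrow> real"
  where "l1_seminorm m K \<alpha> = Inf {l1_norm m K c | c. c \<in> l1_cycles m K \<and> l1_class m K c = \<alpha>}"


section \<open>Functors to Abelian groups and functorial semi-norms\<close>

record ('o, 'a, 'b) ab_functor =
  fobj :: "'o \<Rightarrow> 'b monoid"
  fmor :: "'a \<Rightarrow> 'b \<Rightarrow> 'b"

definition l1_homology_functor ::
  "nat \<Rightarrow> ('o, 'a) category \<Rightarrow> ('o, 'a, 's) sset_functor \<Rightarrow> ('o, 'a, ('s \<Rightarrow> real) set) ab_functor"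
  where "l1_homology_functor n C S =
    \<lparr>fobj = (\<lambda>X. l1_homology_group n (sobj S X)),
     fmor = (\<lambda>f. l1_homology_map n (sobj S (Dom C f)) (sobj S (Cod C f)) (smor S f))\<rparr>"

definition degree_set ::
  "('o, 'a) category \<Rightarrow> ('o, 'a, 'b) ab_functor \<Rightarrow> 'o \<Rightarrow> 'b \<Rightarrow> 'o \<Rightarrow> 'b \<Rightarrow> int set"
  where "degree_set C F Y \<beta> X \<alpha> =
    {d. \<exists>f\<in>Mor C Y X. fmor F f \<beta> = \<alpha> [^]\<^bsub>fobj F X\<^esub> d}"

definition weakly_flexible ::
  "('o, 'a) category \<Rightarrow> ('o, 'a, 'b) ab_functor \<Rightarrow> 'o \<Rightarrow> 'b \<Rightarrow> bool"
  where "weakly_flexible C F X \<alpha> \<longleftrightarrow>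
    (\<exists>Y\<in>Ob C. \<exists>\<beta>\<in>carrier (fobj F Y). infinite (degree_set C F Y \<beta> X \<alpha>))"

definition finite_seminorm :: "'b monoid \<Rightarrow> ('b \<Rightarrow> real) \<Rightarrow> bool"
  where "finite_seminorm A N \<longleftrightarrow>
    (\<forall>x\<in>carrier A. 0 \<le> N x) \<and> N \<one>\<^bsub>A\<^esub> = 0 \<and>
    (\<forall>x\<in>carrier A. N (inv\<^bsub>A\<^esub> x) = N x) \<and>
    (\<forall>x\<in>carrier A. \<forall>y\<in>carrier A. N (x \<otimes>\<^bsub>A\<^esub> y) \<le> N x + N y)"

definition homogeneous_seminorm :: "'b monoid \<Rightarrow> ('b \<Rightarrow> real) \<Rightarrow> bool"
  where "homogeneous_seminorm A N \<longleftrightarrow>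
    (\<forall>d::int. d \<noteq> 0 \<longrightarrow> (\<forall>x\<in>carrier A. N (x [^]\<^bsub>A\<^esub> d) = real_of_int \<bar>d\<bar> * N x))"

definition finite_homogeneous_functorial_seminorm ::
  "('o, 'a) category \<Rightarrow> ('o, 'a, 'b) ab_functor \<Rightarrow> ('o \<Rightarrow> 'b \<Rightarrow> real) \<Rightarrow> bool"
  where "finite_homogeneous_functorial_seminorm C F N \<longleftrightarrow>
    (\<forall>X\<in>Ob C. finite_seminorm (fobj F X) (N X) \<and> homogeneous_seminorm (fobj F X) (N X)) \<and>
    (\<forall>X\<in>Ob C. \<forall>Y\<in>Ob C. \<forall>f\<in>Mor C X Y. \<forall>\<alpha>\<in>carrier (fobj F X).
       N Y (fmor F f \<alpha>) \<le> N X \<alpha>)"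

end

theory Submission
  imports Defs
begin

text \<open>The \<open>\<ell>\<^sup>1\<close>-semi-norm is itself a finite homogeneous functorial semi-norm, and a weakly flexible
  class \<open>\<alpha>\<close> satisfies \<open>|d| |\<alpha>| \<le> |\<beta>|\<close> for infinitely many integers \<open>d\<close>. Conversely, if
  \<open>\<parallel>\<alpha>\<parallel>\<^sub>1 = 0\<close>, choose cycles \<open>c\<^sub>k\<close> representing \<open>\<alpha>\<close> with \<open>|c\<^sub>k|\<^sub>1 < 2\<^sup>-\<^sup>k / (k + 1)\<close> and let \<open>\<beta>\<close> be the
  class of \<open>\<Sum>\<^sub>k k \<cdot> \<iota>\<^sub>k(c\<^sub>k)\<close> in the coproduct of countably many copies of \<open>X\<close>. The morphism that is
  the identity on the \<open>d\<close>-th copy and factors through the point on all others sends \<open>\<beta>\<close> to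
  \<open>d \<cdot> \<alpha>\<close>, because the point has no homology in positive degrees.\<close>

section \<open>Chains and boundaries\<close>

lemma l1_chains_zero: "(\<lambda>s. 0) \<in> l1_chains m K"
  by (simp add: l1_chains_def)

lemma l1_chains_add:
  assumes "c \<in> l1_chains m K" and "d \<in> l1_chains m K"
  shows "(\<lambda>s. c s + d s) \<in> l1_chains m K"
    and "l1_norm m K (\<lambda>s. c s + d s) \<le> l1_norm m K c + l1_norm m K d"
proof -
  have sum: "(\<lambda>s. \<bar>c s\<bar> + \<bar>d s\<bar>) summable_on simplices K m"
    using assms by (intro summable_on_add) (auto simp: l1_chains_def)
  then have abs: "(\<lambda>s. \<bar>c s + d s\<bar>) summable_on simplices K m"
    by (rule summable_on_comparison_test) auto
  then show "(\<lambda>s. c s + d s) \<in> l1_chains m K"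
    using assms by (simp add: l1_chains_def)
  have "l1_norm m K (\<lambda>s. c s + d s) \<le> (\<Sum>\<^sub>\<infinity>s\<in>simplices K m. \<bar>c s\<bar> + \<bar>d s\<bar>)"
    unfolding l1_norm_def by (rule infsum_mono[OF abs sum]) simp
  also have "\<dots> = l1_norm m K c + l1_norm m K d"
    unfolding l1_norm_def using assms by (intro infsum_add) (auto simp: l1_chains_def)
  finally show "l1_norm m K (\<lambda>s. c s + d s) \<le> l1_norm m K c + l1_norm m K d" .
qed

lemma l1_chains_scale: "c \<in> l1_chains m K \<Longrightarrow> (\<lambda>s. r * c s) \<in> l1_chains m K"
  by (auto simp: l1_chains_def abs_mult intro: summable_on_cmult_right)

lemma l1_norm_scale: "l1_norm m K (\<lambda>s. r * c s) = \<bar>r\<bar> * l1_norm m K c"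
  by (simp add: l1_norm_def abs_mult infsum_cmult_right')

lemma l1_norm_nonneg: "0 \<le> l1_norm m K c"
  by (simp add: l1_norm_def infsum_nonneg)

lemma l1_push_scale: "l1_push A \<phi> (\<lambda>s. r * c s) t = r * l1_push A \<phi> c t"
  by (simp add: l1_push_def infsum_cmult_right')

lemma l1_push_zero: "l1_push A \<phi> (\<lambda>s. 0) t = 0"
  by (simp add: l1_push_def)

text \<open>Simplices outside the support of \<open>c\<close> contribute nothing to any fibre sum. A
  map may therefore be exchanged on all simplices where the chain vanishes, in particular on whole
  copies of a simplicial set.\<close>

lemma l1_push_cong:
  assumes "\<And>s. s \<in> A \<Longrightarrow> c s \<noteq> 0 \<Longrightarrow> \<phi> s = \<psi> s"
  shows "l1_push A \<phi> c = l1_push A \<psi> c"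
proof
  fix t
  have "\<forall>s\<in>A. \<phi> s = \<psi> s \<or> c s = 0"
    using assms by blast
  then show "l1_push A \<phi> c t = l1_push A \<psi> c t"
    unfolding l1_push_def by (intro infsum_cong_neutral) force+
qed

lemma l1_push_ident:
  assumes "\<And>s. s \<in> A \<Longrightarrow> \<phi> s = s" and "\<And>s. s \<notin> A \<Longrightarrow> c s = 0"
  shows "l1_push A \<phi> c = c"
proof
  fix t
  have "l1_push A \<phi> c t = (\<Sum>\<^sub>\<infinity>s\<in>{t}. c s)"
    unfolding l1_push_def by (rule infsum_cong_neutral) (use assms in auto)
  then show "l1_push A \<phi> c t = c t" by simp
qed

text \<open>Fubini: the fibre of the composite over \<open>u\<close> is the disjoint union, over all
  \<open>t\<close> in \<open>B\<close> with \<open>\<psi> t = u\<close>, of the fibres of \<phi>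
  over \<open>t\<close>. Absolute summability of \<open>c\<close> permits summing fibre by
  fibre.\<close>

lemma l1_push_push:
  assumes c: "(\<lambda>s. \<bar>c s\<bar>) summable_on A" and \<phi>: "\<phi> \<in> A \<rightarrow> B"
  shows "l1_push B \<psi> (l1_push A \<phi> c) = l1_push A (\<lambda>s. \<psi> (\<phi> s)) c"
proof
  fix u
  let ?B = "{t \<in> B. \<psi> t = u}" and ?F = "\<lambda>t. {s \<in> A. \<phi> s = t}" and ?A = "{s \<in> A. \<psi> (\<phi> s) = u}"
  let ?\<pi> = "\<lambda>s. (\<phi> s, s)"
  have bij: "bij_betw ?\<pi> ?A (Sigma ?B ?F)"
    using \<phi> by (auto simp: bij_betw_def inj_on_def image_iff)
  have "c summable_on A"
    using c by (auto intro: abs_summable_summable)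
  then have "c summable_on ?A"
    by (rule summable_on_subset_banach) auto
  then have S: "(\<lambda>(t, s). c s) summable_on Sigma ?B ?F"
    using summable_on_reindex_bij_betw[OF bij, of "\<lambda>(t, s). c s"] by simp
  have "(\<Sum>\<^sub>\<infinity>t\<in>?B. \<Sum>\<^sub>\<infinity>s\<in>?F t. c s) = (\<Sum>\<^sub>\<infinity>(t, s)\<in>Sigma ?B ?F. c s)"
    using infsum_Sigma'_banach[OF S] by simp
  also have "\<dots> = (\<Sum>\<^sub>\<infinity>s\<in>?A. c s)"
    using infsum_reindex_bij_betw[OF bij, of "\<lambda>(t, s). c s"] by simp
  finally show "l1_push B \<psi> (l1_push A \<phi> c) u = l1_push A (\<lambda>s. \<psi> (\<phi> s)) c u"
    by (simp add: l1_push_def)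
qed

lemma l1_push_sum:
  assumes "finite I" and "\<And>i. i \<in> I \<Longrightarrow> c i \<in> l1_chains m K"
  shows "(\<lambda>s. \<Sum>i\<in>I. r i * c i s) \<in> l1_chains m K"
    and "l1_push (simplices K m) \<phi> (\<lambda>s. \<Sum>i\<in>I. r i * c i s) t =
      (\<Sum>i\<in>I. r i * l1_push (simplices K m) \<phi> (c i) t)"
proof -
  have "(\<lambda>s. \<Sum>i\<in>I. r i * c i s) \<in> l1_chains m K \<and>
    l1_push (simplices K m) \<phi> (\<lambda>s. \<Sum>i\<in>I. r i * c i s) t =
      (\<Sum>i\<in>I. r i * l1_push (simplices K m) \<phi> (c i) t)"
    using assms
  proof (induction I)
    case empty
    then show ?case by (simp add: l1_chains_zero l1_push_zero)
  next
    case (insert j I)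
    then have "(\<lambda>s. r j * c j s) \<in> l1_chains m K"
      and "(\<lambda>s. \<Sum>i\<in>I. r i * c i s) \<in> l1_chains m K"
      by (auto intro: l1_chains_scale)
    from l1_chains_add(1)[OF this] l1_push_add[OF this, of \<phi> t] insert show ?case
      by (simp add: l1_push_scale)
  qed
  then show "(\<lambda>s. \<Sum>i\<in>I. r i * c i s) \<in> l1_chains m K"
    and "l1_push (simplices K m) \<phi> (\<lambda>s. \<Sum>i\<in>I. r i * c i s) t =
      (\<Sum>i\<in>I. r i * l1_push (simplices K m) \<phi> (c i) t)"
    by blast+
qed

section \<open>The boundary operator and its naturality\<close>

lemma l1_boundary_Suc:
  "l1_boundary (Suc k) K c =
    (\<lambda>t. \<Sum>i\<le>Suc k. (-1) ^ i * l1_push (simplices K (Suc k)) (face K k i) c t)"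
  by (simp add: l1_boundary_def)

lemma l1_boundary_0: "l1_boundary 0 K c = (\<lambda>t. 0)"
  by (simp add: l1_boundary_def)

lemma l1_boundary_scale: "l1_boundary m K (\<lambda>s. r * c s) = (\<lambda>t. r * l1_boundary m K c t)"
  by (cases m) (simp_all add: l1_boundary_0 l1_boundary_Suc l1_push_scale sum_distrib_left
      mult.left_commute del: sum.atMost_Suc)

lemma l1_boundary_zero: "l1_boundary m K (\<lambda>s. 0) = (\<lambda>t. 0)"
  using l1_boundary_scale[of m K 0 "\<lambda>s. 0"] by simp

lemma (in simplicial_set) face_closed: "face K k i \<in> simplices K (Suc k) \<rightarrow> simplices K k"
  using act_closed[OF coface_mor] by (auto simp: face_def)

text \<open>By contravariance both sides are actions of composites of two cofaces, and these
  composites are the same monotone map.\<close>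

lemma (in simplicial_set) face_face:
  assumes "i < j" and "j \<le> Suc (Suc k)" and "s \<in> simplices K (Suc (Suc k))"
  shows "face K k i (face K (Suc k) j s) = face K k (j - 1) (face K (Suc k) i s)"
proof -
  have "compose {0..k} (coface (Suc k) j) (coface k i) =
      compose {0..k} (coface (Suc k) i) (coface k (j - 1))"
    using assms(1) by (auto simp: compose_def coface_def fun_eq_iff)
  then show ?thesis
    using assms(3) by (simp add: face_def act_comp[OF coface_mor coface_mor, symmetric])
qed

text \<open>Sign-reversing pairing: a pair (i, j) with i < j is matched with (j - 1, i), which lies
  in the complementary half of the index set, has the same value of \<open>P\<close> and the
  opposite sign. The halves are \<open>?U\<close> and \<open>?L\<close>.\<close>

lemma alternating_double_sum_zero:
  fixes P :: "nat \<Rightarrow> nat \<Rightarrow> 'a :: comm_ring_1"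
  assumes "\<And>i j. i < j \<Longrightarrow> j \<le> Suc m \<Longrightarrow> P i j = P (j - 1) i"
  shows "(\<Sum>i\<le>m. (-1) ^ i * (\<Sum>j\<le>Suc m. (-1) ^ j * P i j)) = 0"
proof -
  let ?f = "\<lambda>(i, j). (-1) ^ (i + j) * P i j"
  let ?U = "{(i, j). i < j \<and> j \<le> Suc m}" and ?L = "{(i, j). j \<le> i \<and> i \<le> m}"
  have fin: "finite ?U" "finite ?L"
    by (rule finite_subset[of _ "{..Suc m} \<times> {..Suc m}"]; auto)+
  have "(\<Sum>i\<le>m. (-1) ^ i * (\<Sum>j\<le>Suc m. (-1) ^ j * P i j)) = sum ?f ({..m} \<times> {..Suc m})"
    by (simp add: sum_distrib_left power_add mult.assoc sum.cartesian_product del: sum.atMost_Suc)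
  also have "{..m} \<times> {..Suc m} = ?U \<union> ?L" by auto
  also have "sum ?f (?U \<union> ?L) = sum ?f ?U + sum ?f ?L"
    by (rule sum.union_disjoint) (use fin in auto)
  also have "sum ?f ?U = sum (\<lambda>x. - ?f x) ?L"
  proof (rule sum.reindex_bij_witness[where i = "\<lambda>(a, b). (b, Suc a)"
        and j = "\<lambda>(i, j). (j - 1, i)"])
    fix x assume x: "x \<in> ?U"
    then obtain i j where ij: "x = (i, Suc j)" "i \<le> j" "j \<le> m"
      by (cases x; case_tac b) auto
    then show "- ?f ((\<lambda>(i, j). (j - 1, i)) x) = ?f x"
      using assms[of i "Suc j"] by (simp add: add.commute)
  qed auto
  finally show ?thesis by (simp add: sum_negf)
qed

context simplicial_set
begin

lemma l1_boundary_closed: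
  assumes "c \<in> l1_chains (Suc m) K"
  shows "l1_boundary (Suc m) K c \<in> l1_chains m K"
  using l1_boundary_bounded(1) simplicial_set_axioms assms .

text \<open>Composing pushforwards turns the double boundary into an alternating double sum over
  iterated faces, which the simplicial identity cancels in pairs. For \<open>m = 0\<close> the outer
  boundary is zero by convention.\<close>

lemma l1_boundary_boundary:
  assumes c: "c \<in> l1_chains (Suc m) K"
  shows "l1_boundary m K (l1_boundary (Suc m) K c) = (\<lambda>t. 0)"
proof (cases m)
  case 0
  then show ?thesis by (simp add: l1_boundary_0)
next
  case (Suc k)
  let ?A = "simplices K (Suc (Suc k))"
  let ?P = "\<lambda>i j. l1_push ?A (\<lambda>s. face K k i (face K (Suc k) j s)) c"
  have c': "c \<in> l1_chains (Suc (Suc k)) K" using c Suc by simp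
  then have abs: "(\<lambda>s. \<bar>c s\<bar>) summable_on ?A" by (simp add: l1_chains_def)
  note p = l1_push_bounded(1)[OF c' face_closed]
  have "l1_push (simplices K (Suc k)) (face K k i) (l1_boundary (Suc (Suc k)) K c) t =
      (\<Sum>j\<le>Suc (Suc k). (-1) ^ j * ?P i j t)" for i t
    unfolding l1_boundary_Suc[of "Suc k"]
    by (subst l1_push_sum(2)[OF _ p]) (simp_all add: l1_push_push[OF abs face_closed])
  moreover have "?P i j = ?P (j - 1) i" if "i < j" "j \<le> Suc (Suc k)" for i j
    by (rule l1_push_cong) (rule face_face[OF that])
  ultimately show ?thesis
    using alternating_double_sum_zero[of "Suc k" "\<lambda>i j. ?P i j _"]
    by (simp add: l1_boundary_Suc[of k] Suc del: sum.atMost_Suc)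
qed

end

lemma simplicial_map_face:
  assumes "simplicial_map K L \<phi>" and "s \<in> simplices K (Suc k)"
  shows "\<phi> k (face K k i s) = face L k i (\<phi> (Suc k) s)"
  using assms coface_mor by (simp add: simplicial_map_def face_def)

lemma simplicial_map_closed: "simplicial_map K L \<phi> \<Longrightarrow> \<phi> m \<in> simplices K m \<rightarrow> simplices L m"
  by (simp add: simplicial_map_def)

text \<open>Both sides become alternating sums of pushforwards along composites of \<phi> with face
  maps, and simplicial maps commute with faces.\<close>

lemma l1_boundary_push:
  assumes K: "simplicial_set K" and L: "simplicial_set L" and \<phi>: "simplicial_map K L \<phi>"
    and c: "c \<in> l1_chains (Suc k) K"
  shows "l1_boundary (Suc k) L (l1_push (simplices K (Suc k)) (\<phi> (Suc k)) c) =
    l1_push (simplices K k) (\<phi> k) (l1_boundary (Suc k) K c)"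
proof
  fix t
  have abs: "(\<lambda>s. \<bar>c s\<bar>) summable_on simplices K (Suc k)"
    using c by (simp add: l1_chains_def)
  note face = simplicial_set.face_closed[OF K]
  have "l1_push (simplices K (Suc k)) (\<lambda>s. face L k i (\<phi> (Suc k) s)) c =
      l1_push (simplices K (Suc k)) (\<lambda>s. \<phi> k (face K k i s)) c" for i
    by (rule l1_push_cong) (simp add: simplicial_map_face[OF \<phi>])
  then show "l1_boundary (Suc k) L (l1_push (simplices K (Suc k)) (\<phi> (Suc k)) c) t =
      l1_push (simplices K k) (\<phi> k) (l1_boundary (Suc k) K c) t"
    unfolding l1_boundary_Suc
    by (subst l1_push_sum(2)[OF _ l1_push_bounded(1)[OF c face]])
      (simp_all add: l1_push_push[OF abs simplicial_map_closed[OF \<phi>]] l1_push_push[OF abs face]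
        del: sum.atMost_Suc)
qed

section \<open>Cycles and boundaries: linear structure and functoriality\<close>

lemma l1_cycles_chains: "c \<in> l1_cycles m K \<Longrightarrow> c \<in> l1_chains m K"
  by (simp add: l1_cycles_def)

lemma l1_cycles_scale: "c \<in> l1_cycles m K \<Longrightarrow> (\<lambda>s. r * c s) \<in> l1_cycles m K"
  by (simp add: l1_cycles_def l1_chains_scale l1_boundary_scale)

lemma l1_cycles_add:
  "c \<in> l1_cycles m K \<Longrightarrow> d \<in> l1_cycles m K \<Longrightarrow> (\<lambda>s. c s + d s) \<in> l1_cycles m K"
  by (simp add: l1_cycles_def l1_chains_add l1_boundary_add)

lemma l1_cycles_zero: "(\<lambda>s. 0) \<in> l1_cycles m K"
  by (simp add: l1_cycles_def l1_chains_zero l1_boundary_zero)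

text \<open>The factor is real, not just integral: homology is a real vector space, which later
  allows division by \<open>r\<close> in the homogeneity of the semi-norm.\<close>

lemma l1_boundaries_scale: "b \<in> l1_boundaries m K \<Longrightarrow> (\<lambda>s. r * b s) \<in> l1_boundaries m K"
  unfolding l1_boundaries_def
  by (auto intro!: image_eqI[where x = "\<lambda>s. r * _ s"] simp: l1_boundary_scale l1_chains_scale)

lemma l1_boundaries_add:
  assumes "b \<in> l1_boundaries m K" and "d \<in> l1_boundaries m K"
  shows "(\<lambda>s. b s + d s) \<in> l1_boundaries m K"
proof -
  obtain b' d' where "b' \<in> l1_chains (Suc m) K" "b = l1_boundary (Suc m) K b'"
    and "d' \<in> l1_chains (Suc m) K" "d = l1_boundary (Suc m) K d'"
    using assms by (auto simp: l1_boundaries_def)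
  then show ?thesis
    unfolding l1_boundaries_def
    by (intro image_eqI[where x = "\<lambda>s. b' s + d' s"]) (simp_all add: l1_boundary_add l1_chains_add)
qed

lemma l1_boundaries_zero: "(\<lambda>s. 0) \<in> l1_boundaries m K"
  unfolding l1_boundaries_def
  by (rule image_eqI[where x = "\<lambda>s. 0"]) (auto simp: l1_boundary_zero l1_chains_zero)

lemma l1_boundaries_cycles: "simplicial_set K \<Longrightarrow> l1_boundaries m K \<subseteq> l1_cycles m K"
  by (auto simp: l1_boundaries_def l1_cycles_def simplicial_set.l1_boundary_closed
      simplicial_set.l1_boundary_boundary)

lemma l1_cycles_push:
  assumes "simplicial_set K" and "simplicial_set L" and \<phi>: "simplicial_map K L \<phi>"
    and c: "c \<in> l1_cycles m K"
  shows "l1_push (simplices K m) (\<phi> m) c \<in> l1_cycles m L"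
proof (cases m)
  case 0
  then show ?thesis
    using l1_push_bounded(1)[OF l1_cycles_chains[OF c] simplicial_map_closed[OF \<phi>]]
    by (simp add: l1_cycles_def l1_boundary_0)
next
  case (Suc k)
  then show ?thesis
    using c l1_push_bounded(1)[OF l1_cycles_chains[OF c] simplicial_map_closed[OF \<phi>]]
      l1_boundary_push[OF assms(1-3), of c k]
    by (auto simp: l1_cycles_def l1_push_zero)
qed

lemma l1_boundaries_push:
  assumes "simplicial_set K" and "simplicial_set L" and \<phi>: "simplicial_map K L \<phi>"
    and b: "b \<in> l1_boundaries m K"
  shows "l1_push (simplices K m) (\<phi> m) b \<in> l1_boundaries m L"
proof -
  obtain c where c: "c \<in> l1_chains (Suc m) K" and "b = l1_boundary (Suc m) K c"
    using b by (auto simp: l1_boundaries_def)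
  with l1_boundary_push[OF assms(1-3) c] l1_push_bounded(1)[OF c simplicial_map_closed[OF \<phi>]]
  show ?thesis unfolding l1_boundaries_def by (metis image_eqI)
qed

section \<open>Homology groups and the \<open>\<ell>\<^sup>1\<close>-semi-norm\<close>

lemma carrier_l1_cycle_group [simp]: "carrier (l1_cycle_group m K) = l1_cycles m K"
  by (simp add: l1_cycle_group_def)

lemma mult_l1_cycle_group [simp]: "c \<otimes>\<^bsub>l1_cycle_group m K\<^esub> d = (\<lambda>s. c s + d s)"
  by (simp add: l1_cycle_group_def l1_chain_group_def)

lemma one_l1_cycle_group [simp]: "\<one>\<^bsub>l1_cycle_group m K\<^esub> = (\<lambda>s. 0)"
  by (simp add: l1_cycle_group_def l1_chain_group_def)

lemma l1_class_eq: "l1_class m K c = (\<lambda>b s. b s + c s) ` l1_boundaries m K"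
  by (auto simp: l1_class_def r_coset_def)

lemma l1_class_eq_iff:
  "l1_class m K c = l1_class m K d \<longleftrightarrow> (\<lambda>s. c s - d s) \<in> l1_boundaries m K"
proof
  assume eq: "l1_class m K c = l1_class m K d"
  have "c \<in> l1_class m K c"
    unfolding l1_class_eq by (rule image_eqI[OF _ l1_boundaries_zero]) simp
  then obtain b where "b \<in> l1_boundaries m K" "c = (\<lambda>s. b s + d s)"
    unfolding eq by (auto simp: l1_class_eq)
  then show "(\<lambda>s. c s - d s) \<in> l1_boundaries m K" by simp
next
  have sub: "l1_class m K c \<subseteq> l1_class m K d" if "(\<lambda>s. c s - d s) \<in> l1_boundaries m K" for c d
  proof
    fix x assume "x \<in> l1_class m K c"
    then obtain b where "b \<in> l1_boundaries m K" "x = (\<lambda>s. b s + c s)"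
      by (auto simp: l1_class_eq)
    with l1_boundaries_add[OF this(1) that] show "x \<in> l1_class m K d"
      unfolding l1_class_eq by (intro image_eqI[where x = "\<lambda>s. b s + (c s - d s)"]) auto
  qed
  assume "(\<lambda>s. c s - d s) \<in> l1_boundaries m K"
  \<comment> \<open>Negating the difference exchanges \<open>c\<close> and \<open>d\<close>, so
    \<open>sub\<close> yields the reverse inclusion as well.\<close>
  with l1_boundaries_scale[OF this, of "-1"] show "l1_class m K c = l1_class m K d"
    by (intro equalityI sub) simp_all
qed

lemma comm_group_l1_cycle_group: "comm_group (l1_cycle_group m K)"
proof (rule comm_groupI)
  fix c assume "c \<in> carrier (l1_cycle_group m K)"
  then show "\<exists>d\<in>carrier (l1_cycle_group m K). d \<otimes>\<^bsub>l1_cycle_group m K\<^esub> c = \<one>\<^bsub>l1_cycle_group m K\<^esub>"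
    using l1_cycles_scale[of c m K "-1"] by (intro bexI[of _ "\<lambda>s. -1 * c s"]) auto
qed (auto simp: l1_cycles_zero l1_cycles_add algebra_simps)

lemma inv_l1_cycle_group:
  assumes "c \<in> l1_cycles m K"
  shows "inv\<^bsub>l1_cycle_group m K\<^esub> c = (\<lambda>s. - c s)"
proof -
  interpret comm_group "l1_cycle_group m K" by (rule comm_group_l1_cycle_group)
  show ?thesis
    using assms l1_cycles_scale[OF assms, of "-1"] by (intro inv_equality) auto
qed

lemma int_pow_l1_cycle_group:
  assumes c: "c \<in> l1_cycles m K"
  shows "c [^]\<^bsub>l1_cycle_group m K\<^esub> (d :: int) = (\<lambda>s. of_int d * c s)"
proof -
  interpret comm_group "l1_cycle_group m K" by (rule comm_group_l1_cycle_group)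
  have pow: "c [^]\<^bsub>l1_cycle_group m K\<^esub> (k :: nat) = (\<lambda>s. real k * c s)" for k
    by (induction k) (auto simp: algebra_simps)
  \<comment> \<open>For \<open>d < 0\<close> the power is the inverse of the natural power with
    exponent \<open>-d\<close>, hence the instance of the inverse formula at the factor
    \<open>- of_int d\<close>.\<close>
  show ?thesis
    using inv_l1_cycle_group[OF l1_cycles_scale[OF c], of "- of_int d"]
    by (simp add: int_pow_def2 pow)
qed

context simplicial_set
begin

lemma normal_l1_boundaries: "l1_boundaries m K \<lhd> l1_cycle_group m K"
proof -
  interpret comm_group "l1_cycle_group m K" by (rule comm_group_l1_cycle_group)
  have cyc: "l1_boundaries m K \<subseteq> l1_cycles m K"
    by (rule l1_boundaries_cycles) (rule simplicial_set_axioms)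
  have "subgroup (l1_boundaries m K) (l1_cycle_group m K)"
  proof (rule subgroupI)
    fix b assume b: "b \<in> l1_boundaries m K"
    then show "inv\<^bsub>l1_cycle_group m K\<^esub> b \<in> l1_boundaries m K"
      using cyc l1_boundaries_scale[OF b, of "-1"] by (auto simp: inv_l1_cycle_group)
  qed (use cyc l1_boundaries_zero in \<open>auto intro: l1_boundaries_add\<close>)
  then show ?thesis by (simp add: normal_iff_subgroup)
qed

lemma group_l1_homology_group: "group (l1_homology_group m K)"
  unfolding l1_homology_group_def by (rule normal.factorgroup_is_group[OF normal_l1_boundaries])

lemma carrier_l1_homology_group: "carrier (l1_homology_group m K) = l1_class m K ` l1_cycles m K"
  by (simp add: l1_homology_group_def l1_class_def carrier_FactGroup)

lemma mult_l1_class: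
  assumes "c \<in> l1_cycles m K" and "d \<in> l1_cycles m K"
  shows "l1_class m K c \<otimes>\<^bsub>l1_homology_group m K\<^esub> l1_class m K d = l1_class m K (\<lambda>s. c s + d s)"
  using assms normal.rcos_sum[OF normal_l1_boundaries, of c m d]
  by (simp add: l1_homology_group_def l1_class_def)

lemma one_l1_homology_group: "\<one>\<^bsub>l1_homology_group m K\<^esub> = l1_class m K (\<lambda>s. 0)"
  by (simp add: l1_homology_group_def l1_class_eq)

lemma int_pow_l1_class:
  assumes "c \<in> l1_cycles m K"
  shows "l1_class m K c [^]\<^bsub>l1_homology_group m K\<^esub> (d :: int) = l1_class m K (\<lambda>s. of_int d * c s)"
  using assms normal.FactGroup_int_pow[OF normal_l1_boundaries, of c m d]
  by (simp add: l1_homology_group_def l1_class_def int_pow_l1_cycle_group)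

lemma inv_l1_class:
  assumes "c \<in> l1_cycles m K"
  shows "inv\<^bsub>l1_homology_group m K\<^esub> (l1_class m K c) = l1_class m K (\<lambda>s. -1 * c s)"
  using assms l1_cycles_scale[OF assms, of "-1"]
  by (intro group.inv_equality[OF group_l1_homology_group])
    (auto simp: carrier_l1_homology_group mult_l1_class[of "\<lambda>s. - c s" m c] one_l1_homology_group)

end

text \<open>Pushforward sends boundaries to boundaries, so all members of the union defining
  \<open>l1_homology_map\<close> are the same coset; the union is not empty because zero is a
  boundary.\<close>

lemma l1_homology_map_class:
  assumes K: "simplicial_set K" and L: "simplicial_set L" and \<phi>: "simplicial_map K L \<phi>"
    and c: "c \<in> l1_cycles m K"
  shows "l1_homology_map m K L \<phi> (l1_class m K c) =
    l1_class m L (l1_push (simplices K m) (\<phi> m) c)"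
proof -
  have "l1_class m L (l1_push (simplices K m) (\<phi> m) (\<lambda>s. b s + c s)) =
      l1_class m L (l1_push (simplices K m) (\<phi> m) c)" if b: "b \<in> l1_boundaries m K" for b
  proof -
    have "b \<in> l1_cycles m K" using b l1_boundaries_cycles[OF K] by blast
    then have "l1_push (simplices K m) (\<phi> m) (\<lambda>s. b s + c s) t =
        l1_push (simplices K m) (\<phi> m) b t + l1_push (simplices K m) (\<phi> m) c t" for t
      using c by (intro l1_push_add l1_cycles_chains)
    then show ?thesis
      using l1_boundaries_push[OF K L \<phi> b] by (simp add: l1_class_eq_iff)
  qed
  moreover have "l1_boundaries m K \<noteq> {}"
    using l1_boundaries_zero by blast
  ultimately show ?thesis
    by (simp add: l1_homology_map_def l1_class_eq[of m K c])
qed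

section \<open>The semi-norm of a homology class\<close>

lemma l1_seminorm_le_norm:
  "c \<in> l1_cycles m K \<Longrightarrow> l1_seminorm m K (l1_class m K c) \<le> l1_norm m K c"
  unfolding l1_seminorm_def
  by (rule cInf_lower) (auto intro!: bdd_belowI[of _ 0] l1_norm_nonneg)

text \<open>The infimum need not be attained, so the estimates below work with representatives that
  are optimal up to \<epsilon>.\<close>

lemma l1_seminorm_approx:
  assumes "c \<in> l1_cycles m K" and "\<epsilon> > 0"
  obtains c' where "c' \<in> l1_cycles m K" and "l1_class m K c' = l1_class m K c"
    and "l1_norm m K c' < l1_seminorm m K (l1_class m K c) + \<epsilon>"
proof -
  let ?A = "{l1_norm m K c' | c'. c' \<in> l1_cycles m K \<and> l1_class m K c' = l1_class m K c}"
  have "?A \<noteq> {}" using assms by auto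
  moreover have "Inf ?A < l1_seminorm m K (l1_class m K c) + \<epsilon>"
    using assms by (simp add: l1_seminorm_def)
  ultimately obtain x where "x \<in> ?A" "x < l1_seminorm m K (l1_class m K c) + \<epsilon>"
    by (rule cInf_lessD[THEN bexE])
  then show thesis using that by auto
qed

lemma l1_seminorm_nonneg:
  assumes "c \<in> l1_cycles m K"
  shows "0 \<le> l1_seminorm m K (l1_class m K c)"
  unfolding l1_seminorm_def
  by (rule cInf_greatest) (use assms l1_norm_nonneg in auto)

lemma l1_class_scale_cong:
  assumes "l1_class m K c = l1_class m K d"
  shows "l1_class m K (\<lambda>s. r * c s) = l1_class m K (\<lambda>s. r * d s)"
  using l1_boundaries_scale[OF assms[unfolded l1_class_eq_iff], of r]
  by (simp add: l1_class_eq_iff algebra_simps)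

lemma l1_class_add_cong:
  assumes "l1_class m K c = l1_class m K c'" and "l1_class m K d = l1_class m K d'"
  shows "l1_class m K (\<lambda>s. c s + d s) = l1_class m K (\<lambda>s. c' s + d' s)"
  using l1_boundaries_add[OF assms[unfolded l1_class_eq_iff]]
  by (simp add: l1_class_eq_iff algebra_simps)

lemma l1_seminorm_scale_le:
  assumes c: "c \<in> l1_cycles m K"
  shows "l1_seminorm m K (l1_class m K (\<lambda>s. r * c s)) \<le> \<bar>r\<bar> * l1_seminorm m K (l1_class m K c)"
proof (rule field_le_epsilon)
  fix e :: real assume "e > 0"
  \<comment> \<open>The tolerance is divided by \<open>\<bar>r\<bar> + 1\<close> because
    \<open>r\<close> may be 0; multiplied by \<open>\<bar>r\<bar>\<close> it is still at most
    \<open>e\<close>.\<close>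
  then obtain c' where c': "c' \<in> l1_cycles m K" "l1_class m K c' = l1_class m K c"
    and less: "l1_norm m K c' < l1_seminorm m K (l1_class m K c) + e / (\<bar>r\<bar> + 1)"
    by (elim l1_seminorm_approx[OF c, of "e / (\<bar>r\<bar> + 1)", rotated]) (simp add: add_nonneg_pos)
  have "l1_seminorm m K (l1_class m K (\<lambda>s. r * c s)) \<le> l1_norm m K (\<lambda>s. r * c' s)"
    using l1_seminorm_le_norm[OF l1_cycles_scale[OF c'(1), of r]] l1_class_scale_cong[OF c'(2)] by simp
  also have "\<dots> \<le> \<bar>r\<bar> * (l1_seminorm m K (l1_class m K c) + e / (\<bar>r\<bar> + 1))"
    unfolding l1_norm_scale using less by (intro mult_left_mono) auto
  finally have "l1_seminorm m K (l1_class m K (\<lambda>s. r * c s)) \<le>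
      \<bar>r\<bar> * l1_seminorm m K (l1_class m K c) + \<bar>r\<bar> * (e / (\<bar>r\<bar> + 1))"
    by (simp only: distrib_left)
  moreover have "\<bar>r\<bar> * (e / (\<bar>r\<bar> + 1)) \<le> e"
    using \<open>e > 0\<close> by (simp add: field_simps)
  ultimately show "l1_seminorm m K (l1_class m K (\<lambda>s. r * c s)) \<le>
      \<bar>r\<bar> * l1_seminorm m K (l1_class m K c) + e"
    by linarith
qed

text \<open>For nonzero \<open>r\<close> the missing inequality is
  \<open>l1_seminorm_scale_le\<close> for the scaled cycle and the factor
  \<open>1 / r\<close>.\<close>

lemma l1_seminorm_scale:
  assumes c: "c \<in> l1_cycles m K"
  shows "l1_seminorm m K (l1_class m K (\<lambda>s. r * c s)) = \<bar>r\<bar> * l1_seminorm m K (l1_class m K c)"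
proof (cases "r = 0")
  case True
  then show ?thesis
    using l1_seminorm_scale_le[OF c, of 0] l1_seminorm_nonneg[OF l1_cycles_scale[OF c, of 0]] by simp
next
  case False
  then have "l1_seminorm m K (l1_class m K c) \<le>
      \<bar>1 / r\<bar> * l1_seminorm m K (l1_class m K (\<lambda>s. r * c s))"
    using l1_seminorm_scale_le[OF l1_cycles_scale[OF c, of r], of "1 / r"] by simp
  then have "\<bar>r\<bar> * l1_seminorm m K (l1_class m K c) \<le> l1_seminorm m K (l1_class m K (\<lambda>s. r * c s))"
    using False by (simp add: field_simps)
  with l1_seminorm_scale_le[OF c, of r] show ?thesis by simp
qed

lemma l1_seminorm_triangle:
  assumes c: "c \<in> l1_cycles m K" and d: "d \<in> l1_cycles m K"
  shows "l1_seminorm m K (l1_class m K (\<lambda>s. c s + d s)) \<le>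
    l1_seminorm m K (l1_class m K c) + l1_seminorm m K (l1_class m K d)"
proof (rule field_le_epsilon)
  fix e :: real assume e: "e > 0"
  obtain c' where c': "c' \<in> l1_cycles m K" "l1_class m K c' = l1_class m K c"
    "l1_norm m K c' < l1_seminorm m K (l1_class m K c) + e / 2"
    using l1_seminorm_approx[OF c, of "e / 2"] e by auto
  obtain d' where d': "d' \<in> l1_cycles m K" "l1_class m K d' = l1_class m K d"
    "l1_norm m K d' < l1_seminorm m K (l1_class m K d) + e / 2"
    using l1_seminorm_approx[OF d, of "e / 2"] e by auto
  have "l1_seminorm m K (l1_class m K (\<lambda>s. c s + d s)) \<le> l1_norm m K (\<lambda>s. c' s + d' s)"
    using l1_seminorm_le_norm[OF l1_cycles_add[OF c'(1) d'(1)]] l1_class_add_cong[OF c'(2) d'(2)]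
    by simp
  also have "\<dots> \<le> l1_norm m K c' + l1_norm m K d'"
    using c'(1) d'(1) by (intro l1_chains_add l1_cycles_chains)
  finally show "l1_seminorm m K (l1_class m K (\<lambda>s. c s + d s)) \<le>
      l1_seminorm m K (l1_class m K c) + l1_seminorm m K (l1_class m K d) + e"
    using c'(3) d'(3) by simp
qed

text \<open>An almost optimal representative is pushed to a representative of the image class, and
  pushforward does not increase the l1-norm.\<close>

lemma l1_seminorm_push:
  assumes K: "simplicial_set K" and L: "simplicial_set L" and \<phi>: "simplicial_map K L \<phi>"
    and c: "c \<in> l1_cycles m K"
  shows "l1_seminorm m L (l1_class m L (l1_push (simplices K m) (\<phi> m) c)) \<le>
    l1_seminorm m K (l1_class m K c)"
proof (rule field_le_epsilon)
  fix e :: real assume "e > 0"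
  then obtain c' where c': "c' \<in> l1_cycles m K" "l1_class m K c' = l1_class m K c"
    and less: "l1_norm m K c' < l1_seminorm m K (l1_class m K c) + e"
    by (rule l1_seminorm_approx[OF c])
  have "l1_class m L (l1_push (simplices K m) (\<phi> m) c) =
      l1_class m L (l1_push (simplices K m) (\<phi> m) c')"
    using l1_homology_map_class[OF K L \<phi> c] l1_homology_map_class[OF K L \<phi> c'(1)] c'(2) by simp
  then have "l1_seminorm m L (l1_class m L (l1_push (simplices K m) (\<phi> m) c)) \<le>
      l1_norm m L (l1_push (simplices K m) (\<phi> m) c')"
    using l1_seminorm_le_norm[OF l1_cycles_push[OF K L \<phi> c'(1)]] by simp
  also have "\<dots> \<le> l1_norm m K c'"
    by (rule l1_push_bounded(2)[OF l1_cycles_chains[OF c'(1)] simplicial_map_closed[OF \<phi>]])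
  finally show "l1_seminorm m L (l1_class m L (l1_push (simplices K m) (\<phi> m) c)) \<le>
      l1_seminorm m K (l1_class m K c) + e"
    using less by simp
qed

section \<open>Functoriality of homology and of the semi-norm\<close>

context sset_functor
begin

lemma fobj_l1_homology_functor [simp]:
  "fobj (l1_homology_functor n C S) X = l1_homology_group n (sobj S X)"
  by (simp add: l1_homology_functor_def)

lemma fmor_l1_homology_functor:
  assumes "X \<in> Ob C" and "Y \<in> Ob C" and f: "f \<in> Mor C X Y" and "c \<in> l1_cycles n (sobj S X)"
  shows "fmor (l1_homology_functor n C S) f (l1_class n (sobj S X) c) =
    l1_class n (sobj S Y) (l1_push (simplices (sobj S X) n) (smor S f n) c)"
proof -
  have "Dom C f = X" "Cod C f = Y" using f by (auto simp: Mor_def)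
  then show ?thesis
    using assms by (simp add: l1_homology_functor_def l1_homology_map_class sobj_sset smor_map)
qed

text \<open>Makes the l1-semi-norm an admissible instance of condition (2), so that (2) implies
  (3).\<close>

lemma l1_seminorm_functorial:
  "finite_homogeneous_functorial_seminorm C (l1_homology_functor n C S)
    (\<lambda>X. l1_seminorm n (sobj S X))"
proof -
  have "finite_seminorm (l1_homology_group n (sobj S X)) (l1_seminorm n (sobj S X)) \<and>
      homogeneous_seminorm (l1_homology_group n (sobj S X)) (l1_seminorm n (sobj S X))"
    if "X \<in> Ob C" for X
  proof -
    let ?K = "sobj S X"
    interpret K: simplicial_set ?K by (rule sobj_sset[OF that])
    have "l1_seminorm n ?K (l1_class n ?K (\<lambda>s. 0)) = 0"
      using l1_seminorm_scale[OF l1_cycles_zero, of n ?K 0] by simp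
    moreover have "l1_seminorm n ?K (l1_class n ?K (\<lambda>s. - c s)) = l1_seminorm n ?K (l1_class n ?K c)"
      if "c \<in> l1_cycles n ?K" for c
      using l1_seminorm_scale[OF that, of "-1"] by simp
    ultimately show ?thesis
      by (auto simp: finite_seminorm_def homogeneous_seminorm_def K.carrier_l1_homology_group
          K.mult_l1_class K.one_l1_homology_group K.int_pow_l1_class K.inv_l1_class
          l1_seminorm_nonneg l1_seminorm_scale l1_seminorm_triangle)
  qed
  moreover have "l1_seminorm n (sobj S Y) (fmor (l1_homology_functor n C S) f \<alpha>) \<le>
      l1_seminorm n (sobj S X) \<alpha>"
    if X: "X \<in> Ob C" and Y: "Y \<in> Ob C" and f: "f \<in> Mor C X Y"
      and \<alpha>: "\<alpha> \<in> carrier (l1_homology_group n (sobj S X))" for X Y f \<alpha>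
  proof -
    obtain c where "c \<in> l1_cycles n (sobj S X)" "\<alpha> = l1_class n (sobj S X) c"
      using \<alpha> by (auto simp: simplicial_set.carrier_l1_homology_group[OF sobj_sset[OF X]])
    then show ?thesis
      using fmor_l1_homology_functor[OF X Y f]
        l1_seminorm_push[where \<phi> = "smor S f", OF sobj_sset[OF X] sobj_sset[OF Y] smor_map[OF f]]
      by simp
  qed
  ultimately show ?thesis
    by (simp add: finite_homogeneous_functorial_seminorm_def)
qed

end

section \<open>Homology of a point\<close>

lemma sset_iso_point_singleton:
  assumes "sset_iso K point_sset"
  shows "\<exists>x. simplices K m = {x}"
proof -
  obtain \<phi> \<psi> where \<phi>: "simplicial_map K point_sset \<phi>" and \<psi>: "simplicial_map point_sset K \<psi>"
    and inv: "\<And>s. s \<in> simplices K m \<Longrightarrow> \<psi> m (\<phi> m s) = s"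
    using assms unfolding sset_iso_def by metis
  have "\<psi> m () \<in> simplices K m"
    using simplicial_map_closed[OF \<psi>, of m] by (auto simp: point_sset_def)
  moreover have "s = \<psi> m ()" if "s \<in> simplices K m" for s
    using inv[OF that] by simp
  ultimately show ?thesis by blast
qed

lemma sum_alternating_signs: "(\<Sum>i\<le>m. (-1) ^ i) = (of_bool (even m) :: 'a :: comm_ring_1)"
  by (induction m) auto

text \<open>All \<open>k + 2\<close> faces of the only (k + 1)-simplex coincide, so the coefficient
  is a sum of \<open>k + 2\<close> alternating signs: 1 for odd \<open>k\<close>, 0 for even
  \<open>k\<close>.\<close>

lemma (in simplicial_set) l1_boundary_point:
  assumes x: "\<And>m. simplices K m = {x m}"
  shows "l1_boundary (Suc k) K c (x k) = of_bool (odd k) * c (x (Suc k))"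
proof -
  have "{s \<in> simplices K (Suc k). face K k i s = x k} = {x (Suc k)}" for i
    using face_closed[of k i] x by auto
  then have "l1_boundary (Suc k) K c (x k) = (\<Sum>i\<le>Suc k. (-1) ^ i) * c (x (Suc k))"
    by (simp add: l1_boundary_Suc l1_push_def sum_distrib_right del: sum.atMost_Suc)
  also have "(\<Sum>i\<le>Suc k. (-1) ^ i) = (of_bool (odd k) :: real)"
    unfolding sum_alternating_signs by simp
  finally show ?thesis .
qed

text \<open>For odd \<open>m\<close> the boundary out of degree \<open>m + 1\<close> is bijective,
  so every chain in degree \<open>m\<close> is a boundary. For even \<open>m > 0\<close> the
  boundary out of degree \<open>m\<close> is bijective, so zero is the only cycle. Degree 0 is
  excluded since the homology of the point is nonzero there.\<close>

lemma (in simplicial_set) l1_cycles_point: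
  assumes point: "\<And>m. \<exists>x. simplices K m = {x}" and "m > 0" and z: "z \<in> l1_cycles m K"
  shows "z \<in> l1_boundaries m K"
proof -
  obtain x where x: "\<And>m. simplices K m = {x m}"
    using point by metis
  note b = l1_boundary_point[of x, OF x]
  have out: "z s = 0" if "s \<noteq> x m" for s
    using z that x by (auto simp: l1_cycles_def l1_chains_def)
  show ?thesis
  proof (cases "odd m")
    case True
    \<comment> \<open>The coefficient of \<open>z\<close>, moved to the only simplex one degree
      higher.\<close>
    let ?w = "\<lambda>s. if s = x (Suc m) then z (x m) else 0"
    have w: "?w \<in> l1_chains (Suc m) K"
      by (simp add: l1_chains_def x)
    have "l1_boundary (Suc m) K ?w t = z t" for t
    proof (cases "t = x m")
      case True
      then show ?thesis using b[of m ?w] \<open>odd m\<close> by simp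
    next
      case False
      then show ?thesis
        using l1_boundary_closed[OF w] out x by (auto simp: l1_chains_def)
    qed
    then show ?thesis
      unfolding l1_boundaries_def using w by (intro image_eqI[of _ _ ?w]) auto
  next
    case False
    with \<open>m > 0\<close> obtain k where k: "m = Suc k" "odd k"
      by (cases m) auto
    have "z (x m) = 0"
      using b[of k z] z k by (simp add: l1_cycles_def)
    with out have "z = (\<lambda>s. 0)" by metis
    then show ?thesis by (simp add: l1_boundaries_zero)
  qed
qed

section \<open>Disjoint copies of a simplicial set\<close>

text \<open>A chain on \<open>sset_copies K\<close> is an \<open>\<ell>\<^sup>1\<close>-summable family of chains on \<open>K\<close>; pushing it forward
  along a family of simplicial maps replaces infinite sums of chains.\<close>

definition sset_copies :: "'s sset \<Rightarrow> ('i \<times> 's) sset"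
  where "sset_copies K = \<lparr>simplices = (\<lambda>m. UNIV \<times> simplices K m),
    act = (\<lambda>m n \<theta> p. (fst p, act K m n \<theta> (snd p)))\<rparr>"

lemma simplices_sset_copies [simp]: "simplices (sset_copies K) m = UNIV \<times> simplices K m"
  by (simp add: sset_copies_def)

lemma act_sset_copies [simp]: "act (sset_copies K) m n \<theta> p = (fst p, act K m n \<theta> (snd p))"
  by (simp add: sset_copies_def)

lemma (in simplicial_set) simplicial_set_copies: "simplicial_set (sset_copies K)"
  by unfold_locales (auto simp: act_closed act_id act_comp)

lemma simplicial_map_copies:
  assumes "\<And>i. simplicial_map K L (\<phi> i)"
  shows "simplicial_map (sset_copies K) L (\<lambda>m p. \<phi> (fst p) m (snd p))"
  using assms unfolding simplicial_map_def by (fastforce simp: Pi_iff)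

lemma simplicial_map_ident: "simplicial_map K K (\<lambda>m s. s)"
  by (simp add: simplicial_map_def)

text \<open>Faces preserve the index of the copy, so the fibre over \<open>(i, t)\<close> lies
  entirely in copy \<open>i\<close>.\<close>

lemma l1_boundary_copies: "l1_boundary m (sset_copies K) W (i, t) = l1_boundary m K (\<lambda>s. W (i, s)) t"
proof (cases m)
  case 0
  then show ?thesis by (simp add: l1_boundary_0)
next
  case (Suc k)
  have "l1_push (UNIV \<times> simplices K (Suc k)) (face (sset_copies K) k j) W (i, t) =
      l1_push (simplices K (Suc k)) (face K k j) (\<lambda>s. W (i, s)) t" for j
  proof -
    have "{p \<in> UNIV \<times> simplices K (Suc k). face (sset_copies K) k j p = (i, t)} =
        Pair i ` {s \<in> simplices K (Suc k). face K k j s = t}"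
      by (auto simp: face_def)
    then show ?thesis
      by (simp add: l1_push_def infsum_reindex inj_on_def o_def)
  qed
  then show ?thesis
    by (simp add: Suc l1_boundary_Suc del: sum.atMost_Suc)
qed

text \<open>Fubini for nonnegative families: slices with summable norms assemble to an absolutely
  summable function on the product.\<close>

lemma l1_chains_copies:
  assumes c: "\<And>i. (\<lambda>s. W (i, s)) \<in> l1_chains m K"
    and sum: "(\<lambda>i. l1_norm m K (\<lambda>s. W (i, s))) summable_on UNIV"
  shows "W \<in> l1_chains m (sset_copies K)"
proof -
  have "(\<lambda>p. \<bar>W p\<bar>) summable_on (UNIV \<times> simplices K m)"
  proof (rule summable_on_SigmaI[OF _ sum])
    show "((\<lambda>s. \<bar>W (i, s)\<bar>) has_sum l1_norm m K (\<lambda>s. W (i, s))) (simplices K m)" for i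
      using c[of i] by (auto simp: l1_norm_def l1_chains_def intro: has_sum_infsum)
  qed auto
  then show ?thesis
    using c by (auto simp: l1_chains_def)
qed

lemma l1_cycles_copies:
  assumes "W \<in> l1_chains m (sset_copies K)" and "\<And>i. (\<lambda>s. W (i, s)) \<in> l1_cycles m K"
  shows "W \<in> l1_cycles m (sset_copies K)"
  using assms by (auto simp: l1_cycles_def l1_boundary_copies)

text \<open>Split \<open>W\<close> into \<open>V\<close> on copy \<open>d\<close> and
  \<open>W'\<close> on the remaining copies. On the support of \<open>W'\<close> the map is \<psi>
  after the fold map \<open>snd\<close>. The fold of \<open>W'\<close> is a single cycle of
  \<open>K\<close>, so \<open>null\<close> disposes of infinitely many copies at once.\<close>

lemma l1_class_push_copies:
  fixes \<phi> :: "'i \<Rightarrow> nat \<Rightarrow> 's \<Rightarrow> 't"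
  assumes K: "simplicial_set K" and L: "simplicial_set L"
    and \<phi>: "\<And>i. simplicial_map K L (\<phi> i)" and \<psi>: "simplicial_map K L \<psi>"
    and null: "\<And>z. z \<in> l1_cycles m K \<Longrightarrow> l1_push (simplices K m) (\<psi> m) z \<in> l1_boundaries m L"
    and eq: "\<And>i s. i \<noteq> d \<Longrightarrow> s \<in> simplices K m \<Longrightarrow> \<phi> i m s = \<psi> m s"
    and W: "W \<in> l1_chains m (sset_copies K)" and cyc: "\<And>i. (\<lambda>s. W (i, s)) \<in> l1_cycles m K"
  shows "l1_class m L (l1_push (simplices (sset_copies K) m) (\<lambda>p. \<phi> (fst p) m (snd p)) W) =
    l1_class m L (l1_push (simplices K m) (\<phi> d m) (\<lambda>s. W (d, s)))"
proof -
  let ?A = "simplices (sset_copies K) m" and ?\<Phi> = "\<lambda>p. \<phi> (fst p) m (snd p)"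
  define V where "V p = of_bool (fst p = d) * W p" for p
  define W' where "W' p = of_bool (fst p \<noteq> d) * W p" for p
  have chain: "V \<in> l1_chains m (sset_copies K)" "W' \<in> l1_chains m (sset_copies K)"
  proof -
    have abs: "(\<lambda>p. \<bar>W p\<bar>) summable_on simplices (sset_copies K) m"
      using W by (simp add: l1_chains_def)
    have "(\<lambda>p. \<bar>V p\<bar>) summable_on simplices (sset_copies K) m"
      and "(\<lambda>p. \<bar>W' p\<bar>) summable_on simplices (sset_copies K) m"
      by (rule summable_on_comparison_test[OF abs]; simp add: V_def W'_def abs_mult)+
    then show "V \<in> l1_chains m (sset_copies K)" "W' \<in> l1_chains m (sset_copies K)"
      using W by (simp_all add: l1_chains_def V_def W'_def)
  qed
  \<comment> \<open>Each slice of \<open>W'\<close> is either a slice of \<open>W\<close> or zero,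
    and being a cycle is tested slice by slice.\<close>
  have W': "W' \<in> l1_cycles m (sset_copies K)"
  proof (rule l1_cycles_copies[OF chain(2)])
    show "(\<lambda>s. W' (i, s)) \<in> l1_cycles m K" for i
      using l1_cycles_scale[OF cyc[of i], of "of_bool (i \<noteq> d)"] by (simp only: W'_def fst_conv)
  qed
  have push_W: "l1_push ?A ?\<Phi> W t = l1_push ?A ?\<Phi> V t + l1_push ?A ?\<Phi> W' t" for t
  proof -
    have "W = (\<lambda>p. V p + W' p)" by (auto simp: V_def W'_def)
    then show ?thesis using l1_push_add[OF chain] by simp
  qed
  \<comment> \<open>Since \<open>V\<close> vanishes off copy \<open>d\<close>, each fibre may be cut
    down to its part in that copy, which is a fibre of \<open>\<phi> d m\<close> reindexed by
    \<open>Pair d\<close>.\<close>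
  have push_V: "l1_push ?A ?\<Phi> V = l1_push (simplices K m) (\<phi> d m) (\<lambda>s. W (d, s))"
  proof
    fix t
    let ?F = "{s \<in> simplices K m. \<phi> d m s = t}"
    have "l1_push ?A ?\<Phi> V t = (\<Sum>\<^sub>\<infinity>p\<in>Pair d ` ?F. W p)"
      unfolding l1_push_def
    proof (rule infsum_cong_neutral)
      fix p assume "p \<in> {p \<in> ?A. ?\<Phi> p = t} - Pair d ` ?F"
      then have "fst p \<noteq> d" by (cases p) auto
      then show "V p = 0" by (simp add: V_def)
    next
      fix p assume p: "p \<in> Pair d ` ?F - {p \<in> ?A. ?\<Phi> p = t}"
      then obtain s where "p = (d, s)" "s \<in> ?F" by blast
      with p show "W p = 0" by simp
    next
      fix p assume "p \<in> {p \<in> ?A. ?\<Phi> p = t} \<inter> Pair d ` ?F"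
      then have "fst p = d" by (elim IntE imageE) simp
      then show "V p = W p" by (simp add: V_def)
    qed
    also have "\<dots> = (\<Sum>\<^sub>\<infinity>s\<in>?F. W (d, s))"
      by (simp add: infsum_reindex inj_on_def o_def)
    finally show "l1_push ?A ?\<Phi> V t = l1_push (simplices K m) (\<phi> d m) (\<lambda>s. W (d, s)) t"
      by (simp add: l1_push_def)
  qed
  have snd: "simplicial_map (sset_copies K) K (\<lambda>m p. snd p)"
    by (rule simplicial_map_copies) (rule simplicial_map_ident)
  have "l1_push ?A ?\<Phi> W' = l1_push ?A (\<lambda>p. \<psi> m (snd p)) W'"
    by (rule l1_push_cong) (auto simp: W'_def eq)
  also have "\<dots> = l1_push (simplices K m) (\<psi> m) (l1_push ?A snd W')"
    using chain(2) by (intro l1_push_push[symmetric]) (auto simp: l1_chains_def)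
  also have "\<dots> \<in> l1_boundaries m L"
    by (rule null) (rule l1_cycles_push[OF simplicial_set.simplicial_set_copies[OF K] K snd W'])
  finally have "l1_push ?A ?\<Phi> W' \<in> l1_boundaries m L" .
  then show ?thesis
    unfolding l1_class_eq_iff push_W push_V by simp
qed

section \<open>Weakly flexible classes\<close>

lemma weakly_flexible_seminorm_zero:
  assumes flex: "weakly_flexible C F X \<alpha>"
    and N: "finite_homogeneous_functorial_seminorm C F N"
    and X: "X \<in> Ob C" and \<alpha>: "\<alpha> \<in> carrier (fobj F X)"
  shows "N X \<alpha> = 0"
proof (rule ccontr)
  assume "N X \<alpha> \<noteq> 0"
  with N X \<alpha> have pos: "N X \<alpha> > 0"
    by (force simp: finite_homogeneous_functorial_seminorm_def finite_seminorm_def)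
  obtain Y \<beta> where Y: "Y \<in> Ob C" and \<beta>: "\<beta> \<in> carrier (fobj F Y)"
    and inf: "infinite (degree_set C F Y \<beta> X \<alpha>)"
    using flex by (auto simp: weakly_flexible_def)
  \<comment> \<open>The floor makes the bound an integer, so that the degrees lie in a finite
    integer interval.\<close>
  have "\<bar>d\<bar> \<le> \<lfloor>N Y \<beta> / N X \<alpha>\<rfloor>" if d: "d \<in> degree_set C F Y \<beta> X \<alpha>" for d
  proof -
    obtain f where f: "f \<in> Mor C Y X" and eq: "fmor F f \<beta> = \<alpha> [^]\<^bsub>fobj F X\<^esub> d"
      using d by (auto simp: degree_set_def)
    have "real_of_int \<bar>d\<bar> * N X \<alpha> \<le> N Y \<beta>"
    \<comment> \<open>Homogeneity speaks of nonzero \<open>d\<close> only; for \<open>d = 0\<close>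
      the claim is nonnegativity of \<open>N Y \<beta>\<close>.\<close>
    proof (cases "d = 0")
      case True
      then show ?thesis
        using N Y \<beta> by (simp add: finite_homogeneous_functorial_seminorm_def finite_seminorm_def)
    next
      case False
      then have "real_of_int \<bar>d\<bar> * N X \<alpha> = N X (fmor F f \<beta>)"
        using N X \<alpha> unfolding eq
        by (simp add: finite_homogeneous_functorial_seminorm_def homogeneous_seminorm_def)
      also have "\<dots> \<le> N Y \<beta>"
        using N X Y f \<beta> by (simp add: finite_homogeneous_functorial_seminorm_def)
      finally show ?thesis .
    qed
    then show ?thesis
      using pos by (simp add: le_floor_iff field_simps)
  qed
  then have "degree_set C F Y \<beta> X \<alpha> \<subseteq> {- \<lfloor>N Y \<beta> / N X \<alpha>\<rfloor>..\<lfloor>N Y \<beta> / N X \<alpha>\<rfloor>}"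
    by (force simp: abs_le_iff)
  with inf show False
    using finite_subset by blast
qed

lemma weakly_flexible_if_l1_seminorm_zero:
  fixes C :: "('o, 'a) category" and S :: "('o, 'a, 's) sset_functor"
  assumes S: "sset_functor C S" and n: "n > 0" and pt: "pt \<in> Ob C"
    and iso: "sset_iso (sobj S pt) point_sset" and X: "X \<in> Ob C"
    and repl: "replicable C X" and pointable: "pointable C pt X"
    and \<alpha>: "\<alpha> \<in> carrier (l1_homology_group n (sobj S X))"
    and zero: "l1_seminorm n (sobj S X) \<alpha> = 0"
  shows "weakly_flexible C (l1_homology_functor n C S) X \<alpha>"
proof -
  interpret sset_functor C S by (rule S)
  let ?F = "l1_homology_functor n C S" and ?K = "sobj S X"
  interpret K: simplicial_set ?K by (rule sobj_sset[OF X])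
  obtain Y \<iota> where coprod: "is_coproduct C (UNIV :: nat set) (\<lambda>_. X) Y \<iota>"
    using repl by (auto simp: replicable_def)
  then have Y: "Y \<in> Ob C" and \<iota>: "\<And>k. \<iota> k \<in> Mor C X Y"
    by (simp_all add: is_coproduct_def)
  have univ: "\<exists>h. h \<in> Mor C Y X \<and> (\<forall>k. Comp C h (\<iota> k) = g k)"
    if "\<And>k. g k \<in> Mor C X X" for g
  proof -
    have "\<exists>!h. h \<in> Mor C Y X \<and> (\<forall>k\<in>UNIV. Comp C h (\<iota> k) = g k)"
      using coprod X that unfolding is_coproduct_def by blast
    then show ?thesis by auto
  qed
  obtain p q where p: "p \<in> Mor C X pt" and q: "q \<in> Mor C pt X"
    using pointable by (auto simp: pointable_def)
  \<comment> \<open>An endomorphism of \<open>X\<close> through the point; \<open>null\<close> shows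
    that it induces zero in degree \<open>n\<close>, since \<open>n > 0\<close>.\<close>
  let ?e = "Comp C q p"
  have e: "?e \<in> Mor C X X" using p q by (rule Comp_Mor)
  have null: "l1_push (simplices ?K n) (smor S ?e n) z \<in> l1_boundaries n ?K"
    if z: "z \<in> l1_cycles n ?K" for z
  proof -
    have abs: "(\<lambda>s. \<bar>z s\<bar>) summable_on simplices ?K n"
      using z by (simp add: l1_cycles_def l1_chains_def)
    have "l1_push (simplices ?K n) (smor S p n) z \<in> l1_boundaries n (sobj S pt)"
      using simplicial_set.l1_cycles_point[OF sobj_sset[OF pt] sset_iso_point_singleton[OF iso] n]
        l1_cycles_push[OF sobj_sset[OF X] sobj_sset[OF pt] smor_map[OF p] z] .
    from l1_boundaries_push[OF sobj_sset[OF pt] sobj_sset[OF X] smor_map[OF q] this]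
    have "l1_push (simplices ?K n) (\<lambda>s. smor S q n (smor S p n s)) z \<in> l1_boundaries n ?K"
      by (simp add: l1_push_push[OF abs simplicial_map_closed[OF smor_map[OF p]]])
    also have "l1_push (simplices ?K n) (\<lambda>s. smor S q n (smor S p n s)) z =
        l1_push (simplices ?K n) (smor S ?e n) z"
      by (rule l1_push_cong) (simp add: smor_comp[OF p q])
    finally show ?thesis .
  qed
  obtain c0 where c0: "c0 \<in> l1_cycles n ?K" "\<alpha> = l1_class n ?K c0"
    using \<alpha> by (auto simp: K.carrier_l1_homology_group)
  \<comment> \<open>The denominator absorbs the weight \<open>k\<close> that \<open>c k\<close>
    receives in \<open>W\<close> and is positive also for \<open>k = 0\<close>; the factor
    \<open>(1/2) ^ k\<close> then makes the weighted norms summable.\<close>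
  have "\<exists>c. c \<in> l1_cycles n ?K \<and> l1_class n ?K c = \<alpha> \<and> l1_norm n ?K c < (1/2) ^ k / (real k + 1)"
    for k :: nat
    using l1_seminorm_approx[OF c0(1), of "(1/2) ^ k / (real k + 1)"] zero c0(2)
    by (auto simp: add_nonneg_pos)
  then obtain c where c: "\<And>k. c k \<in> l1_cycles n ?K" and c_class: "\<And>k. l1_class n ?K (c k) = \<alpha>"
    and c_norm: "\<And>k. l1_norm n ?K (c k) < (1/2) ^ k / (real k + 1)"
    by metis
  define W where "W p = real (fst p) * c (fst p) (snd p)" for p
  have W_eq: "(\<lambda>s. W (k, s)) = (\<lambda>s. real k * c k s)" for k
    by (simp add: W_def)
  have W_cyc: "(\<lambda>s. W (k, s)) \<in> l1_cycles n ?K" for k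
    unfolding W_eq by (rule l1_cycles_scale[OF c])
  have "l1_norm n ?K (\<lambda>s. W (k, s)) \<le> (1/2) ^ k" for k
  proof -
    have "real k * l1_norm n ?K (c k) \<le> (real k + 1) * ((1/2) ^ k / (real k + 1))"
      using c_norm[of k] by (intro mult_mono) (auto simp: l1_norm_nonneg)
    then show ?thesis by (simp add: W_eq l1_norm_scale)
  qed
  moreover have geometric: "(\<lambda>k. (1/2 :: real) ^ k) summable_on UNIV"
    by (rule norm_summable_imp_summable_on) (simp add: norm_power)
  ultimately have "(\<lambda>k. l1_norm n ?K (\<lambda>s. W (k, s))) summable_on UNIV"
    by (intro summable_on_comparison_test[OF geometric]) (simp_all add: l1_norm_nonneg)
  then have W_chain: "W \<in> l1_chains n (sset_copies ?K)"
    using W_cyc by (intro l1_chains_copies l1_cycles_chains)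
  let ?A = "simplices (sset_copies ?K :: (nat \<times> 's) sset) n"
  \<comment> \<open>\<open>S\<close> may fail to preserve coproducts, so the inclusions are
    assembled into one simplicial map from the disjoint copies of \<open>?K\<close> to
    \<open>sobj S Y\<close>, along which \<open>W\<close> is pushed.\<close>
  define \<iota>' where "\<iota>' m p = smor S (\<iota> (fst p)) m (snd p)" for m p
  have \<iota>': "simplicial_map (sset_copies ?K) (sobj S Y) \<iota>'"
    unfolding \<iota>'_def by (intro simplicial_map_copies smor_map[OF \<iota>])
  define b where "b = l1_push ?A (\<iota>' n) W"
  have b: "b \<in> l1_cycles n (sobj S Y)"
    unfolding b_def
    by (rule l1_cycles_push[OF K.simplicial_set_copies sobj_sset[OF Y] \<iota>'
          l1_cycles_copies[OF W_chain W_cyc]])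
  define \<beta> where "\<beta> = l1_class n (sobj S Y) b"
  have \<beta>: "\<beta> \<in> carrier (fobj ?F Y)"
    using b by (simp add: \<beta>_def simplicial_set.carrier_l1_homology_group[OF sobj_sset[OF Y]])
  have "int d \<in> degree_set C ?F Y \<beta> X \<alpha>" for d
  proof -
    \<comment> \<open>This family isolates copy \<open>d\<close>, the one whose slice carries the
      weight \<open>d\<close>.\<close>
    let ?g = "\<lambda>k. if k = d then Ident C X else ?e"
    have g: "?g k \<in> Mor C X X" for k
      using e Ident_Mor[OF X] by simp
    obtain h where h: "h \<in> Mor C Y X" and h_\<iota>: "\<And>k. Comp C h (\<iota> k) = ?g k"
      using univ[of ?g, OF g] by blast
    have "l1_push (simplices (sobj S Y) n) (smor S h n) b =
        l1_push ?A (\<lambda>p. smor S h n (\<iota>' n p)) W"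
      unfolding b_def using W_chain simplicial_map_closed[OF \<iota>']
      by (intro l1_push_push) (simp_all add: l1_chains_def)
    \<comment> \<open>Functoriality of \<open>S\<close> and \<open>h_\<iota>\<close> eliminate
      \<open>Y\<close>: the chain is now pushed directly from the copies to
      \<open>?K\<close>.\<close>
    also have "\<dots> = l1_push ?A (\<lambda>p. smor S (?g (fst p)) n (snd p)) W"
      by (rule l1_push_cong) (auto simp: \<iota>'_def smor_comp[OF \<iota> h, symmetric] h_\<iota>)
    finally have "fmor ?F h \<beta> =
        l1_class n ?K (l1_push ?A (\<lambda>p. smor S (?g (fst p)) n (snd p)) W)"
      by (simp add: \<beta>_def fmor_l1_homology_functor[OF Y X h b])
    also have "\<dots> = l1_class n ?K (l1_push (simplices ?K n) (smor S (?g d) n) (\<lambda>s. W (d, s)))"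
      by (rule l1_class_push_copies[where \<phi> = "\<lambda>k. smor S (?g k)" and \<psi> = "smor S ?e" and d = d,
            OF K.simplicial_set_axioms K.simplicial_set_axioms smor_map[OF g] smor_map[OF e]
            null _ W_chain W_cyc])
        simp_all
    also have "l1_push (simplices ?K n) (smor S (?g d) n) (\<lambda>s. W (d, s)) = (\<lambda>s. W (d, s))"
      by (rule l1_push_ident) (use W_cyc in \<open>auto simp: smor_id[OF X] l1_cycles_def l1_chains_def\<close>)
    \<comment> \<open>Every \<open>c k\<close> represents the same \<alpha>, so the slice at
      \<open>d\<close> represents \<open>d\<close> times \<alpha>, a power in multiplicative
      notation.\<close>
    also have "l1_class n ?K (\<lambda>s. W (d, s)) = \<alpha> [^]\<^bsub>fobj ?F X\<^esub> int d"
      using K.int_pow_l1_class[OF c, of d "int d"] by (simp add: W_eq c_class)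
    finally show ?thesis
      using h by (auto simp: degree_set_def)
  qed
  \<comment> \<open>The class \<beta> does not depend on \<open>d\<close>, so it alone realises
    every natural number as a degree.\<close>
  then have "range int \<subseteq> degree_set C ?F Y \<beta> X \<alpha>" by auto
  moreover have "infinite (range int)"
    by (simp add: finite_image_iff inj_on_def)
  ultimately have "infinite (degree_set C ?F Y \<beta> X \<alpha>)"
    using finite_subset by blast
  then show ?thesis
    using Y \<beta> by (auto simp: weakly_flexible_def)
qed

theorem theorem5p9:
  fixes C :: "('o, 'a) category"
    and S :: "('o, 'a, 's) sset_functor"
    and n :: nat
    and pt X :: 'o
    and \<alpha> :: "('s \<Rightarrow> real) set"
  assumes "category C"
    and "sset_functor C S"
    and "n > 0"
    and "pt \<in> Ob C"
    and "sset_iso (sobj S pt) point_sset"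
    and "X \<in> Ob C"
    and "replicable C X"
    and "pointable C pt X"
    and "\<alpha> \<in> carrier (fobj (l1_homology_functor n C S) X)"
  shows "(weakly_flexible C (l1_homology_functor n C S) X \<alpha> \<longleftrightarrow>
            (\<forall>N. finite_homogeneous_functorial_seminorm C (l1_homology_functor n C S) N \<longrightarrow> N X \<alpha> = 0)) \<and>
         ((\<forall>N. finite_homogeneous_functorial_seminorm C (l1_homology_functor n C S) N \<longrightarrow> N X \<alpha> = 0) \<longleftrightarrow>
            l1_seminorm n (sobj S X) \<alpha> = 0)"
proof -
  interpret sset_functor C S by fact
  let ?F = "l1_homology_functor n C S"
  \<comment> \<open>The equivalences follow from the cycle of implications (1) to (2), (2) to (3)
    and (3) to (1).\<close>
  have "N X \<alpha> = 0" if "weakly_flexible C ?F X \<alpha>"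
    and "finite_homogeneous_functorial_seminorm C ?F N" for N
    using weakly_flexible_seminorm_zero that assms(6,9) .
  moreover have "l1_seminorm n (sobj S X) \<alpha> = 0"
    if "\<forall>N. finite_homogeneous_functorial_seminorm C ?F N \<longrightarrow> N X \<alpha> = 0"
    using that l1_seminorm_functorial[of n] by blast
  moreover have "weakly_flexible C ?F X \<alpha>" if "l1_seminorm n (sobj S X) \<alpha> = 0"
    using weakly_flexible_if_l1_seminorm_zero[OF assms(2-8)] assms(9) that by simp
  ultimately show ?thesis by blast
qed

end
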